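(* Let $h\in \mathbb{H}$ with continued fraction digits $CF(h)=\{\gamma_i\}$, associated to a fundamental domain $K$ with $\operatorname{rad}(K)<1$, and rational approximants $\mathbb K \{\gamma_i\}_{i=1}^n = \left(\frac{r_n}{q_n}, \frac{p_n}{q_n}\right)$. Then $$ v - \overline{ \left( \frac{r_n}{q_n} \right) } u +\overline{\left( \frac{p_n}{q_n} \right)} = \frac{1}{ \overline{q_n} (q_{n+1}+\tilde q_{n+1}u_{n+1} - q_{n}v_{n+1})}.$$
   Context: $\mathbb H=\mathbb C\times\mathbb R$ is the Heisenberg group with law $(z,t)*(z',t')=(z+z',t+t'+2\operatorname{Im}(\overline z z'))$ and gauge norm $\|(z,t)\|=\sqrt[4]{|z|^4+t^2}$; $\mathbb H(\mathbb Z)=\mathbb Z[i]\times\mathbb Z$; $K$ is a fundamental domain for $\mathbb H(\mathbb Z)$ with $\operatorname{rad}(K)=\sup_{k\in K}\|k\|<1$. Points are written in planar Siegel coordinates $(z,t)\mapsto(z(1+i),|z|^2+it)$: $h=(u,v)$, and the forward iterates $h_n=T^n h$ (for $h\in K$, $T(x)=[\iota x]^{-1}*\iota x$, with $[x]=g$ iff $x\in g*K$ and $\iota(z,t)=\left(\frac{-z}{|z|^2+it},\frac{-t}{|z|^4+t^2}\right)$; digits $\gamma_i=[\iota h_{i-1}]$) have coordinates $(u_n,v_n)$. For $\gamma$ with Siegel coordinates $(\alpha,\beta)$ let $A_\gamma=\begin{pmatrix}-\beta&-\overline\alpha&-1\\ \alpha&1&0\\ -1&0&0\end{pmatrix}$,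 $Q_n=A_{\gamma_1}\cdots A_{\gamma_n}$, $(q_n,r_n,p_n)^T=Q_n(1,0,0)^T$ (with $(q_0,r_0,p_0)=(1,0,0)$, $(q_{-1},r_{-1},p_{-1})=(0,0,1)$), and $\tilde q_n=\overline{r_n q_{n-1}-q_n r_{n-1}}$ (the $(1,2)$ entry of $Q_n$).
   Formalization: The right-hand side is proved with the opposite sign, −1/(…), since the printed sign already fails at n = 0; q̃ is read as the (1,2) entry of Q (the conjugate formula differs by (−1)^n); h lies in K and h_0,…,h_n are nonzero, so that γ_{n+1} exists. *)

theory Defs
  imports "HOL-Analysis.Analysis"
begin

type_synonym heis = "complex \<times> real"

definition heis_mult :: "heis \<Rightarrow> heis \<Rightarrow> heis" where
  "heis_mult x y = (fst x + fst y, snd x + snd y + 2 * Im (cnj (fst x) * fst y))"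

definition heis_inv :: "heis \<Rightarrow> heis" where
  "heis_inv x = (- fst x, - snd x)"

definition heis_norm :: "heis \<Rightarrow> real" where
  "heis_norm x = root 4 (norm (fst x) ^ 4 + (snd x)\<^sup>2)"

definition heis_iota :: "heis \<Rightarrow> heis" where
  "heis_iota x =
     (- fst x / (complex_of_real ((norm (fst x))\<^sup>2) + \<i> * complex_of_real (snd x)),
      - snd x / (norm (fst x) ^ 4 + (snd x)\<^sup>2))"

definition heis_lattice :: "heis set" where
  "heis_lattice = {g. Re (fst g) \<in> \<int> \<and> Im (fst g) \<in> \<int> \<and> snd g \<in> \<int>}"

text \<open>An exact tiling: the translates of K by lattice points partition the group, so that
  the nearest-point map below is well defined everywhere.\<close>

definition fundamental_domain :: "heis set \<Rightarrow> bool" where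
  "fundamental_domain K \<longleftrightarrow> (\<forall>x. \<exists>!g. g \<in> heis_lattice \<and> x \<in> heis_mult g ` K)"

text \<open>Extended-real valued, so that \<open>heis_rad K < 1\<close> entails that K is bounded.\<close>

definition heis_rad :: "heis set \<Rightarrow> ereal" where
  "heis_rad K = (SUP k\<in>K. ereal (heis_norm k))"

definition heis_floor :: "heis set \<Rightarrow> heis \<Rightarrow> heis" where
  "heis_floor K x = (THE g. g \<in> heis_lattice \<and> x \<in> heis_mult g ` K)"

definition cf_T :: "heis set \<Rightarrow> heis \<Rightarrow> heis" where
  "cf_T K x = heis_mult (heis_inv (heis_floor K (heis_iota x))) (heis_iota x)"

definition cf_iterate :: "heis set \<Rightarrow> heis \<Rightarrow> nat \<Rightarrow> heis" where
  "cf_iterate K h n = (cf_T K ^^ n) h"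

text \<open>The digits are indexed from 1.  The digit with index \<open>i \<ge> 1\<close> is meaningful only if
  the iterates with index \<open>0, \<dots>, i - 1\<close> are all different from the origin; otherwise the
  expansion has terminated earlier.\<close>

definition cf_digit :: "heis set \<Rightarrow> heis \<Rightarrow> nat \<Rightarrow> heis" where
  "cf_digit K h i = heis_floor K (heis_iota (cf_iterate K h (i - 1)))"

text \<open>Planar Siegel coordinates.\<close>

definition siegel_u :: "heis \<Rightarrow> complex" where
  "siegel_u x = fst x * (1 + \<i>)"

definition siegel_v :: "heis \<Rightarrow> complex" where
  "siegel_v x = complex_of_real ((norm (fst x))\<^sup>2) + \<i> * complex_of_real (snd x)"

definition cf_A :: "heis \<Rightarrow> complex^3^3" where
  "cf_A g = vector [vector [- siegel_v g, - cnj (siegel_u g), -1],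
                    vector [siegel_u g, 1, 0],
                    vector [-1, 0, 0]]"

primrec cf_Q :: "(nat \<Rightarrow> heis) \<Rightarrow> nat \<Rightarrow> complex^3^3" where
  "cf_Q \<gamma> 0 = mat 1"
| "cf_Q \<gamma> (Suc n) = cf_Q \<gamma> n ** cf_A (\<gamma> (Suc n))"

definition cf_q :: "(nat \<Rightarrow> heis) \<Rightarrow> nat \<Rightarrow> complex" where
  "cf_q \<gamma> n = (cf_Q \<gamma> n *v vector [1, 0, 0]) $ 1"

definition cf_r :: "(nat \<Rightarrow> heis) \<Rightarrow> nat \<Rightarrow> complex" where
  "cf_r \<gamma> n = (cf_Q \<gamma> n *v vector [1, 0, 0]) $ 2"

definition cf_p :: "(nat \<Rightarrow> heis) \<Rightarrow> nat \<Rightarrow> complex" where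
  "cf_p \<gamma> n = (cf_Q \<gamma> n *v vector [1, 0, 0]) $ 3"

text \<open>Often written as \<open>cnj (r\<^sub>n * q\<^bsub>n-1\<^esub> - q\<^sub>n * r\<^bsub>n-1\<^esub>)\<close>; since the matrices \<open>cf_A\<close>
  have determinant \<open>-1\<close>, that expression equals the (1,2) entry only up to the sign
  \<open>(-1)^n\<close>, see \<open>cf_qt_Suc\<close> below.\<close>

definition cf_qt :: "(nat \<Rightarrow> heis) \<Rightarrow> nat \<Rightarrow> complex" where
  "cf_qt \<gamma> n = cf_Q \<gamma> n $ 1 $ 2"

lemma siegel_horospherical:
  "siegel_u g * cnj (siegel_u g) = siegel_v g + cnj (siegel_v g)"
  unfolding siegel_u_def siegel_v_def cmod_power2
  by (simp add: complex_eq_iff algebra_simps power2_eq_square)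

lemma cf_Q_Suc_entries:
  "cf_Q \<gamma> (Suc n) $ i $ 1 = - siegel_v (\<gamma> (Suc n)) * cf_Q \<gamma> n $ i $ 1
     + siegel_u (\<gamma> (Suc n)) * cf_Q \<gamma> n $ i $ 2 - cf_Q \<gamma> n $ i $ 3"
  "cf_Q \<gamma> (Suc n) $ i $ 2 = - cnj (siegel_u (\<gamma> (Suc n))) * cf_Q \<gamma> n $ i $ 1 + cf_Q \<gamma> n $ i $ 2"
  "cf_Q \<gamma> (Suc n) $ i $ 3 = - cf_Q \<gamma> n $ i $ 1"
  by (simp_all add: cf_A_def matrix_matrix_mult_def sum_3 vector_3)

lemma cf_Q_minors:
  fixes \<gamma> :: "nat \<Rightarrow> heis" and n :: nat
  defines "M \<equiv> \<lambda>j k. cf_Q \<gamma> n $ 1 $ j * cf_Q \<gamma> n $ 2 $ k - cf_Q \<gamma> n $ 2 $ j * cf_Q \<gamma> n $ 1 $ k"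
  shows "cnj (cf_Q \<gamma> n $ 1 $ 1) = (-1) ^ n * M 1 2"
    and "cnj (cf_Q \<gamma> n $ 1 $ 2) = (-1) ^ n * M 1 3"
    and "cnj (cf_Q \<gamma> n $ 1 $ 3) = (-1) ^ n * M 2 3"
  unfolding M_def
proof (induction n)
  case 0
  {
    case 1 show ?case by (simp add: mat_def)
  next
    case 2 show ?case by (simp add: mat_def)
  next
    case 3 show ?case by (simp add: mat_def)
  }
next
  case (Suc n)
  have b: "cnj (siegel_v (\<gamma> (Suc n)))
      = siegel_u (\<gamma> (Suc n)) * cnj (siegel_u (\<gamma> (Suc n))) - siegel_v (\<gamma> (Suc n))"
    by (simp add: siegel_horospherical)
  {
    case 1 show ?case
      by (simp add: cf_Q_Suc_entries Suc.IH b algebra_simps del: cf_Q.simps)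
  next
    case 2 show ?case
      by (simp add: cf_Q_Suc_entries Suc.IH b algebra_simps del: cf_Q.simps)
  next
    case 3 show ?case
      by (simp add: cf_Q_Suc_entries Suc.IH b algebra_simps del: cf_Q.simps)
  }
qed

lemma cf_qt_Suc:
  "cf_qt \<gamma> (Suc n) =
     (-1) ^ Suc n * cnj (cf_r \<gamma> (Suc n) * cf_q \<gamma> n - cf_q \<gamma> (Suc n) * cf_r \<gamma> n)"
proof -
  have q: "cf_q \<gamma> m = cf_Q \<gamma> m $ 1 $ 1" and r: "cf_r \<gamma> m = cf_Q \<gamma> m $ 2 $ 1" for m
    by (simp_all add: cf_q_def cf_r_def matrix_vector_mult_def sum_3 vector_3)
  have "cnj (cf_qt \<gamma> (Suc n)) =
      (-1) ^ Suc n * (cf_r \<gamma> (Suc n) * cf_q \<gamma> n - cf_q \<gamma> (Suc n) * cf_r \<gamma> n)"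
    unfolding cf_qt_def q r
    by (simp only: cf_Q_minors(2)[of \<gamma> "Suc n"] cf_Q_Suc_entries(3)) (simp add: algebra_simps)
  from arg_cong[OF this, of cnj] show ?thesis by simp
qed

end

theory Submission
  imports Defs
begin

text \<open>Represent a point \<open>x\<close> with Siegel coordinates \<open>(u, v)\<close> by the null vector \<open>X(x) = (1, u, v)\<close> of the
  form \<open>\<langle>x, y\<rangle> = x\<^sub>3 \<cdot> cnj y\<^sub>1 - x\<^sub>2 \<cdot> cnj y\<^sub>2 + x\<^sub>1 \<cdot> cnj y\<^sub>3\<close>, which every \<open>cf_A g\<close> preserves.
  One step of the algorithm reads \<open>X(h\<^sub>i) = - v\<^sub>i \<cdot> A X(h\<^sub>i\<^sub>+\<^sub>1)\<close>, so \<open>X(h)\<close> is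
  \<open>\<Prod>\<^sub>i\<^sub><\<^sub>n (- v\<^sub>i) \<cdot> Q\<^sub>n X(h\<^sub>n)\<close>.  Pairing this with \<open>Q\<^sub>n e\<^sub>1 = (q\<^sub>n, r\<^sub>n, p\<^sub>n)\<close> evaluates the numerator of the
  left-hand side as \<open>- \<Prod>\<^sub>i\<^sub>\<le>\<^sub>n (- v\<^sub>i)\<close>, while the first coordinate at level \<open>n + 1\<close> shows that
  the bracket on the right is the inverse of \<open>\<Prod>\<^sub>i\<^sub>\<le>\<^sub>n (- v\<^sub>i)\<close>.

  If \<open>q\<^sub>n\<close> vanished, then so would \<open>r\<^sub>n\<close>, because \<open>Q\<^sub>n e\<^sub>1\<close> is null.  The pairing would then give
  \<open>\<bar>p\<^sub>n\<bar> = \<Prod>\<^sub>i\<^sub>\<le>\<^sub>n \<bar>v\<^sub>i\<bar>\<close>, which lies strictly between 0 and 1 as \<open>rad(K) < 1\<close>; but \<open>p\<^sub>n\<close> is a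
  Gaussian integer.\<close>

section \<open>Siegel vectors and the invariant Hermitian form\<close>

definition siegel_vec :: "heis \<Rightarrow> complex^3" where
  "siegel_vec x = vector [1, siegel_u x, siegel_v x]"

definition siegel_form :: "complex^3 \<Rightarrow> complex^3 \<Rightarrow> complex" where
  "siegel_form x y = x $ 3 * cnj (y $ 1) - x $ 2 * cnj (y $ 2) + x $ 1 * cnj (y $ 3)"

lemma siegel_form_scale_left: "siegel_form (c *s x) y = c * siegel_form x y"
  by (simp add: siegel_form_def algebra_simps)

text \<open>Eliminating \<open>cnj (siegel_v g)\<close> by the horospherical relation makes all
  terms in \<open>g\<close> cancel.\<close>

lemma siegel_form_cf_A: "siegel_form (cf_A g *v x) (cf_A g *v y) = siegel_form x y"
proof -
  have b: "cnj (siegel_v g) = siegel_u g * cnj (siegel_u g) - siegel_v g"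
    by (simp add: siegel_horospherical)
  show ?thesis
    by (simp add: siegel_form_def cf_A_def matrix_vector_mult_def sum_3 vector_3 b algebra_simps)
qed

lemma siegel_form_cf_Q: "siegel_form (cf_Q \<gamma> n *v x) (cf_Q \<gamma> n *v y) = siegel_form x y"
  by (induction n arbitrary: x y)
    (simp_all add: siegel_form_cf_A flip: matrix_vector_mul_assoc)

section \<open>Group law, inversion and the algorithm in Siegel coordinates\<close>

lemma siegel_v_eq_0_iff: "siegel_v x = 0 \<longleftrightarrow> x = (0, 0)"
  by (cases x) (auto simp: siegel_v_def complex_eq_iff)

lemma siegel_v_heis_mult:
  "siegel_v (heis_mult x y) = siegel_v x + cnj (siegel_u x) * siegel_u y + siegel_v y"
  unfolding siegel_u_def siegel_v_def heis_mult_def cmod_power2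
  by (simp add: complex_eq_iff algebra_simps power2_eq_square)

lemma siegel_u_heis_mult: "siegel_u (heis_mult x y) = siegel_u x + siegel_u y"
  by (simp add: siegel_u_def heis_mult_def algebra_simps)

lemma norm_siegel_v_power2: "(norm (siegel_v x))\<^sup>2 = norm (fst x) ^ 4 + (snd x)\<^sup>2"
proof -
  have "(norm (siegel_v x))\<^sup>2 = ((norm (fst x))\<^sup>2)\<^sup>2 + (snd x)\<^sup>2"
    unfolding cmod_power2[of "siegel_v x"] by (simp add: siegel_v_def)
  then show ?thesis by simp
qed

lemma heis_iota_siegel_v:
  "heis_iota x = (- fst x / siegel_v x, - snd x / (norm (siegel_v x))\<^sup>2)"
  by (simp only: heis_iota_def norm_siegel_v_power2) (simp only: siegel_v_def)

lemma siegel_u_heis_iota: "siegel_u (heis_iota x) = - siegel_u x / siegel_v x"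
  by (simp add: siegel_u_def heis_iota_siegel_v)

lemma siegel_v_heis_iota: "siegel_v (heis_iota x) = 1 / siegel_v x"
proof (cases "x = (0, 0)")
  case False
  have v: "siegel_v x \<noteq> 0" using False by (simp add: siegel_v_eq_0_iff)
  define N where "N = (norm (siegel_v x))\<^sup>2"
  have z: "(norm (fst (heis_iota x)))\<^sup>2 = (norm (fst x))\<^sup>2 / N"
    by (simp add: heis_iota_siegel_v norm_divide power_divide N_def)
  have t: "snd (heis_iota x) = - snd x / N"
    by (simp add: heis_iota_siegel_v N_def)
  have "siegel_v (heis_iota x) = cnj (siegel_v x) / complex_of_real N"
    unfolding siegel_v_def[of "heis_iota x"] z t
    by (simp add: siegel_v_def diff_divide_distrib)
  also have "\<dots> = 1 / siegel_v x"
    using v by (simp add: complex_div_cnj[of 1 "siegel_v x"] N_def)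
  finally show ?thesis .
\<comment> \<open>At the origin both sides are 0, since division by 0 yields 0.\<close>
qed (simp add: siegel_v_def heis_iota_def)

lemma heis_mult_inv_cancel: "heis_mult g (heis_mult (heis_inv g) x) = x"
  by (cases g; cases x) (simp add: heis_mult_def heis_inv_def algebra_simps)

lemma heis_inv_mult_cancel: "heis_mult (heis_inv g) (heis_mult g x) = x"
  by (cases g; cases x) (simp add: heis_mult_def heis_inv_def algebra_simps)

text \<open>As \<open>heis_iota x\<close> is \<open>g\<close> times \<open>cf_T K x\<close>,
  applying \<open>cf_A g\<close> gives \<open>(-1/v, -u/v, -1)\<close>, with \<open>u\<close>,
  \<open>v\<close> the coordinates of \<open>x\<close>; the factor \<open>- v\<close> normalizes the
  first entry to 1.\<close>

lemma siegel_vec_cf_T: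
  assumes "x \<noteq> (0, 0)"
  shows "siegel_vec x = (- siegel_v x) *s (cf_A (heis_floor K (heis_iota x)) *v siegel_vec (cf_T K x))"
proof -
  define g where "g = heis_floor K (heis_iota x)"
  have g: "heis_mult g (cf_T K x) = heis_iota x"
    by (simp add: cf_T_def g_def heis_mult_inv_cancel)
  have u: "siegel_u g + siegel_u (cf_T K x) = - siegel_u x / siegel_v x"
    by (simp only: siegel_u_heis_iota g flip: siegel_u_heis_mult)
  have v: "siegel_v g + cnj (siegel_u g) * siegel_u (cf_T K x) + siegel_v (cf_T K x) = 1 / siegel_v x"
    by (simp only: siegel_v_heis_iota g flip: siegel_v_heis_mult)
  have "cf_A g *v siegel_vec (cf_T K x)
      = vector [- (1 / siegel_v x), - siegel_u x / siegel_v x, -1]"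
    unfolding u[symmetric] v[symmetric]
    by (simp add: vec_eq_iff forall_3 cf_A_def siegel_vec_def matrix_vector_mult_def sum_3 vector_3)
  then show ?thesis
    using assms
    by (simp add: g_def[symmetric] vec_eq_iff forall_3 siegel_vec_def vector_3 siegel_v_eq_0_iff)
qed

lemma siegel_vec_cf_iterate:
  assumes "\<forall>i<n. cf_iterate K h i \<noteq> (0, 0)"
  shows "siegel_vec h = (\<Prod>i<n. - siegel_v (cf_iterate K h i)) *s
    (cf_Q (cf_digit K h) n *v siegel_vec (cf_iterate K h n))"
  using assms
proof (induction n)
  case 0
  show ?case by (simp add: cf_iterate_def)
next
  case (Suc n)
  let ?x = "cf_iterate K h n"
  \<comment> \<open>Index shift: digit \<open>Suc n\<close> is read off from iterate
    \<open>n\<close>.\<close>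
  have x: "siegel_vec ?x
      = (- siegel_v ?x) *s (cf_A (cf_digit K h (Suc n)) *v siegel_vec (cf_iterate K h (Suc n)))"
    using siegel_vec_cf_T[of ?x K] Suc.prems by (simp add: cf_digit_def cf_iterate_def)
  have "siegel_vec h = (\<Prod>i<n. - siegel_v (cf_iterate K h i)) *s
      (cf_Q (cf_digit K h) n *v siegel_vec ?x)"
    using Suc by simp
  then show ?case
    by (subst (asm) x)
      (simp only: matrix_vector_mul_assoc vector_scalar_commute vector_smult_assoc cf_Q.simps
        prod.lessThan_Suc)
qed

section \<open>Size of the iterates and integrality of the matrices\<close>

lemma heis_floor_props:
  assumes "fundamental_domain K"
  shows "heis_floor K x \<in> heis_lattice" and "x \<in> heis_mult (heis_floor K x) ` K"
proof -
  have "\<exists>!g. g \<in> heis_lattice \<and> x \<in> heis_mult g ` K"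
    using assms unfolding fundamental_domain_def by blast
  from theI'[OF this] show "heis_floor K x \<in> heis_lattice" "x \<in> heis_mult (heis_floor K x) ` K"
    by (simp_all add: heis_floor_def)
qed

lemma cf_T_in:
  assumes "fundamental_domain K"
  shows "cf_T K x \<in> K"
proof -
  from heis_floor_props(2)[OF assms, of "heis_iota x"]
  obtain k where "k \<in> K" "heis_iota x = heis_mult (heis_floor K (heis_iota x)) k" by blast
  then show ?thesis by (metis cf_T_def heis_inv_mult_cancel)
qed

lemma cf_iterate_in:
  assumes "fundamental_domain K" and "h \<in> K"
  shows "cf_iterate K h n \<in> K"
  by (cases n) (simp_all add: cf_iterate_def assms cf_T_in)

lemma cf_digit_in_lattice:
  assumes "fundamental_domain K"
  shows "cf_digit K h n \<in> heis_lattice"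
  by (simp add: cf_digit_def heis_floor_props(1) assms)

text \<open>The modulus of \<open>siegel_v x\<close> is the square of the gauge norm.\<close>

lemma norm_siegel_v_less_1:
  assumes "heis_rad K < 1" and "x \<in> K"
  shows "norm (siegel_v x) < 1"
proof -
  have "ereal (heis_norm x) \<le> heis_rad K"
    unfolding heis_rad_def using assms(2) by (rule SUP_upper)
  with assms(1) have "ereal (heis_norm x) < 1" by (rule order.strict_trans1[rotated])
  then have "root 4 ((norm (siegel_v x))\<^sup>2) < 1"
    by (simp add: heis_norm_def norm_siegel_v_power2)
  then have "(norm (siegel_v x))\<^sup>2 < 1" by simp
  then show ?thesis by (simp add: power_less_one_iff)
qed

definition gaussian_ints :: "complex set" where
  "gaussian_ints = {z. Re z \<in> \<int> \<and> Im z \<in> \<int>}"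

lemma gaussian_ints_closed:
  "0 \<in> gaussian_ints" "1 \<in> gaussian_ints"
  "z \<in> gaussian_ints \<Longrightarrow> - z \<in> gaussian_ints"
  "z \<in> gaussian_ints \<Longrightarrow> cnj z \<in> gaussian_ints"
  "z \<in> gaussian_ints \<Longrightarrow> w \<in> gaussian_ints \<Longrightarrow> z + w \<in> gaussian_ints"
  "z \<in> gaussian_ints \<Longrightarrow> w \<in> gaussian_ints \<Longrightarrow> z - w \<in> gaussian_ints"
  "z \<in> gaussian_ints \<Longrightarrow> w \<in> gaussian_ints \<Longrightarrow> z * w \<in> gaussian_ints"
  by (auto simp: gaussian_ints_def)

lemma gaussian_ints_norm_less_1:
  assumes "z \<in> gaussian_ints" and "norm z < 1"
  shows "z = 0"
  using assms abs_Re_le_cmod[of z] abs_Im_le_cmod[of z]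
  by (auto simp: gaussian_ints_def complex_eq_iff elim!: Ints_cases)

lemma siegel_in_gaussian_ints:
  assumes "g \<in> heis_lattice"
  shows "siegel_u g \<in> gaussian_ints" and "siegel_v g \<in> gaussian_ints"
  using assms
  by (auto simp: heis_lattice_def gaussian_ints_def siegel_u_def siegel_v_def cmod_power2)

lemma cf_Q_in_gaussian_ints:
  assumes "\<And>i. \<gamma> i \<in> heis_lattice"
  shows "cf_Q \<gamma> n $ i $ j \<in> gaussian_ints"
proof (induction n arbitrary: j)
  case 0
  show ?case by (simp add: mat_def gaussian_ints_closed)
next
  case (Suc n)
  note closed = gaussian_ints_closed siegel_in_gaussian_ints[OF assms] Suc.IH
  show ?case
    using exhaust_3[of j]
    by (auto simp only: cf_Q_Suc_entries intro!: closed)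
qed

section \<open>Numerator, denominator and nonvanishing of \<open>q\<close>\<close>

lemma cf_Q_first_column:
  "cf_q \<gamma> n = cf_Q \<gamma> n $ 1 $ 1" "cf_r \<gamma> n = cf_Q \<gamma> n $ 2 $ 1" "cf_p \<gamma> n = cf_Q \<gamma> n $ 3 $ 1"
  by (simp_all add: cf_q_def cf_r_def cf_p_def matrix_vector_mult_def sum_3 vector_3)

lemma siegel_form_cf_Q_first_column:
  "siegel_form x (cf_Q \<gamma> n *v vector [1, 0, 0])
    = x $ 3 * cnj (cf_q \<gamma> n) - x $ 2 * cnj (cf_r \<gamma> n) + x $ 1 * cnj (cf_p \<gamma> n)"
  by (simp add: siegel_form_def cf_q_def cf_r_def cf_p_def)

lemma cf_numerator_eq_prod:
  assumes "\<forall>i<n. cf_iterate K h i \<noteq> (0, 0)"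
  defines "\<gamma> \<equiv> cf_digit K h"
  shows "siegel_v h * cnj (cf_q \<gamma> n) - siegel_u h * cnj (cf_r \<gamma> n) + cnj (cf_p \<gamma> n)
    = - (\<Prod>i\<le>n. - siegel_v (cf_iterate K h i))"
proof -
  let ?e = "vector [1, 0, 0] :: complex^3"
  have "siegel_v h * cnj (cf_q \<gamma> n) - siegel_u h * cnj (cf_r \<gamma> n) + cnj (cf_p \<gamma> n)
      = siegel_form (siegel_vec h) (cf_Q \<gamma> n *v ?e)"
    by (simp add: siegel_form_cf_Q_first_column siegel_vec_def vector_3)
  also have "\<dots> = (\<Prod>i<n. - siegel_v (cf_iterate K h i)) *
      siegel_form (siegel_vec (cf_iterate K h n)) ?e"
    by (subst siegel_vec_cf_iterate[OF assms(1)])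
      (simp add: siegel_form_scale_left siegel_form_cf_Q \<gamma>_def)
  \<comment> \<open>Pairing with the first basis vector leaves \<open>v\<close> of iterate
    \<open>n\<close>, which is minus the missing factor of index \<open>n\<close>; this is where the
    sign arises.\<close>
  also have "\<dots> = - (\<Prod>i\<le>n. - siegel_v (cf_iterate K h i))"
    by (simp add: siegel_form_def siegel_vec_def vector_3 flip: lessThan_Suc_atMost)
  finally show ?thesis .
qed

text \<open>The first row of \<open>cf_Q \<gamma> (Suc n)\<close> is
  \<open>(q (n+1), qt (n+1), - q n)\<close>, and the first coordinate of a Siegel vector is
  1.\<close>

lemma cf_denominator_eq_prod:
  assumes "\<forall>i\<le>n. cf_iterate K h i \<noteq> (0, 0)"
  defines "\<gamma> \<equiv> cf_digit K h" and "x \<equiv> cf_iterate K h (Suc n)"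
  shows "(\<Prod>i\<le>n. - siegel_v (cf_iterate K h i)) *
    (cf_q \<gamma> (Suc n) + cf_qt \<gamma> (Suc n) * siegel_u x - cf_q \<gamma> n * siegel_v x) = 1"
proof -
  have "siegel_vec h $ 1 = ((\<Prod>i<Suc n. - siegel_v (cf_iterate K h i)) *s
      (cf_Q \<gamma> (Suc n) *v siegel_vec x)) $ 1"
    unfolding \<gamma>_def x_def
    by (rule arg_cong[OF siegel_vec_cf_iterate]) (use assms(1) in auto)
  also have "\<dots> = (\<Prod>i\<le>n. - siegel_v (cf_iterate K h i)) *
      (cf_q \<gamma> (Suc n) + cf_qt \<gamma> (Suc n) * siegel_u x - cf_q \<gamma> n * siegel_v x)"
    by (simp add: matrix_vector_mult_def sum_3 siegel_vec_def vector_3 cf_Q_first_column cf_qt_def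
        cf_Q_Suc_entries(3) lessThan_Suc_atMost del: cf_Q.simps prod.lessThan_Suc)
  finally show ?thesis by (simp add: siegel_vec_def vector_3)
qed

lemma cf_first_column_null:
  "2 * Re (cf_p \<gamma> n * cnj (cf_q \<gamma> n)) = (norm (cf_r \<gamma> n))\<^sup>2"
proof -
  let ?e = "vector [1, 0, 0] :: complex^3"
  have "siegel_form (cf_Q \<gamma> n *v ?e) (cf_Q \<gamma> n *v ?e) = 0"
    by (subst siegel_form_cf_Q) (simp add: siegel_form_def vector_3)
  from arg_cong[OF this, of Re] show ?thesis
    unfolding cmod_power2
    by (simp add: siegel_form_def cf_q_def cf_r_def cf_p_def power2_eq_square algebra_simps)
qed

lemma cf_q_nonzero:
  assumes "fundamental_domain K" and "heis_rad K < 1" and "h \<in> K"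
    and nz: "\<forall>i\<le>n. cf_iterate K h i \<noteq> (0, 0)"
  shows "cf_q (cf_digit K h) n \<noteq> 0"
proof
  let ?\<gamma> = "cf_digit K h"
  assume q: "cf_q ?\<gamma> n = 0"
  then have r: "cf_r ?\<gamma> n = 0"
    using cf_first_column_null[of ?\<gamma> n] by simp
  have p: "norm (cf_p ?\<gamma> n) = (\<Prod>i\<le>n. norm (siegel_v (cf_iterate K h i)))"
    using arg_cong[OF cf_numerator_eq_prod[of n K h], of norm] nz q r
    by (simp add: norm_mult flip: prod_norm)
  have "norm (siegel_v (cf_iterate K h i)) < 1" for i
    using norm_siegel_v_less_1[OF assms(2)] cf_iterate_in[OF assms(1,3)] by blast
  \<comment> \<open>The instance \<open>0\<close> is an index at which the inequality is strict; it
    lies in the range for every \<open>n\<close>.\<close>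
  then have "(\<Prod>i\<le>n. norm (siegel_v (cf_iterate K h i))) < (\<Prod>i\<le>n. 1)"
    using nz by (intro prod_mono_strict[of 0]) (auto simp: siegel_v_eq_0_iff less_imp_le)
  moreover have "cf_p ?\<gamma> n \<in> gaussian_ints"
    unfolding cf_Q_first_column using cf_digit_in_lattice[OF assms(1)] by (rule cf_Q_in_gaussian_ints)
  ultimately have "cf_p ?\<gamma> n = 0"
    using p by (intro gaussian_ints_norm_less_1) simp_all
  with p nz show False
    by (auto simp: siegel_v_eq_0_iff)
qed

theorem theorem3p23:
  fixes K :: "heis set" and h :: heis and n :: nat
    and \<gamma> :: "nat \<Rightarrow> heis" and u v q r p qt :: "nat \<Rightarrow> complex"
  defines "\<gamma> \<equiv> cf_digit K h"
    and "u \<equiv> \<lambda>i. siegel_u (cf_iterate K h i)"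
    and "v \<equiv> \<lambda>i. siegel_v (cf_iterate K h i)"
    and "q \<equiv> cf_q \<gamma>" and "r \<equiv> cf_r \<gamma>" and "p \<equiv> cf_p \<gamma>" and "qt \<equiv> cf_qt \<gamma>"
  assumes "fundamental_domain K"
    and "heis_rad K < 1"
    and "h \<in> K"
    and "\<forall>i\<le>n. cf_iterate K h i \<noteq> (0, 0)"
  shows "siegel_v h - cnj (r n / q n) * siegel_u h + cnj (p n / q n)
       = - 1 / (cnj (q n) * (q (n + 1) + qt (n + 1) * u (n + 1) - q n * v (n + 1)))"
proof -
  define P where "P = (\<Prod>i\<le>n. - siegel_v (cf_iterate K h i))"
  define D where "D = q (n + 1) + qt (n + 1) * u (n + 1) - q n * v (n + 1)"
  have q: "q n \<noteq> 0"
    unfolding q_def \<gamma>_def using assms(8-11) by (rule cf_q_nonzero)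
  have num: "siegel_v h * cnj (q n) - siegel_u h * cnj (r n) + cnj (p n) = - P"
    unfolding P_def q_def r_def p_def \<gamma>_def using assms(11) by (intro cf_numerator_eq_prod) auto
  have "P * D = 1"
    using cf_denominator_eq_prod[OF assms(11)]
    by (simp add: P_def D_def q_def qt_def u_def v_def \<gamma>_def)
  then have D: "P = 1 / D" by (metis mult_zero_right nonzero_eq_divide_eq zero_neq_one)
  have "siegel_v h - cnj (r n / q n) * siegel_u h + cnj (p n / q n) = - P / cnj (q n)"
    using q by (simp flip: num add: field_simps)
  \<comment> \<open>The sign can be checked at \<open>n = 0\<close>: the left-hand side is
    \<open>siegel_v h\<close>, while \<open>D\<close> is \<open>- 1 / siegel_v h\<close>.\<close>
  also have "\<dots> = - 1 / (cnj (q n) * D)" by (simp add: D)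
  finally show ?thesis unfolding D_def .
qed

end
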